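(* Let $d\in\{24,27,30,33,35,36,38,39,41,42\}\cup\{i\in\mathbb{Z}\mid i\ge 44\}$. Then there exist two non-isomorphic integral lattices $L_1,L_2$ of rank $4d$ with the same theta series, i.e. $\theta_{L_1}(q)=\theta_{L_2}(q)$.
   Context: A lattice of rank $n$ is a subgroup $L\subset\mathbb{R}^n$ of the form $L=\mathbb{Z}e_1\oplus\cdots\oplus\mathbb{Z}e_n$ for some basis $\{e_1,\ldots,e_n\}$ of $\mathbb{R}^n$. With $(x,y)$ the standard inner product on $\mathbb{R}^n$, $L$ is integral if $(x,y)\in\mathbb{Z}$ for all $x,y\in L$. Two lattices of rank $n$ are isomorphic if there is a group isomorphism between them preserving the inner product (equivalently, an orthogonal transformation of $\mathbb{R}^n$ mapping one onto the other). The theta series of an integral lattice $L$ is $$\theta_L(q)=\sum_{x\in L}q^{(x,x)},\qquad q=e^{\pi i z},\ \operatorname{Im}(z)>0.$$ Thus $\theta_{L_1}=\theta_{L_2}$ means that for each integer $k\ge 0$ the two lattices have the same number of vectors $x$ with $(x,x)=k$. *)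

theory Defs
  imports "HOL-Analysis.Analysis"
begin

text \<open>Full-rank lattices in a Euclidean space; the rank is \<open>DIM('a)\<close>, which is \<open>CARD('n)\<close> for
  \<open>real ^ 'n\<close>. (An independent set in a Euclidean space is finite, so the sum is never a junk value.)\<close>

definition is_lattice :: "'a::euclidean_space set \<Rightarrow> bool" where
  "is_lattice L \<longleftrightarrow>
     (\<exists>B. independent B \<and> span B = UNIV \<and>
          L = {\<Sum>b\<in>B. of_int (c b) *\<^sub>R b | c :: 'a \<Rightarrow> int. True})"

definition integral_lattice :: "'a::euclidean_space set \<Rightarrow> bool" where
  "integral_lattice L \<longleftrightarrow> is_lattice L \<and> (\<forall>x\<in>L. \<forall>y\<in>L. x \<bullet> y \<in> \<int>)"

definition lattice_isomorphic :: "'a::euclidean_space set \<Rightarrow> 'a set \<Rightarrow> bool" where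
  "lattice_isomorphic L1 L2 \<longleftrightarrow>
     (\<exists>f. bij_betw f L1 L2 \<and>
          (\<forall>x\<in>L1. \<forall>y\<in>L1. f (x + y) = f x + f y) \<and>
          (\<forall>x\<in>L1. \<forall>y\<in>L1. f x \<bullet> f y = x \<bullet> y))"

text \<open>The theta series as a function of \<open>z\<close> in the upper half-plane: with \<open>q = exp (\<pi> \<i> z)\<close>, the
  summand is \<open>q\<close> to the power \<open>x \<bullet> x\<close>. For a lattice and \<open>Im z > 0\<close> the sum converges
  absolutely; values at other \<open>z\<close> are meaningless.\<close>

definition theta :: "'a::euclidean_space set \<Rightarrow> complex \<Rightarrow> complex" where
  "theta L z = (\<Sum>\<^sub>\<infinity>x\<in>L. exp (of_real pi * \<i> * z * of_real (x \<bullet> x)))"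

end

theory Submission
  imports Defs
begin

text \<open>A binary linear code \<open>C\<close> of length \<open>n\<close> gives the integral lattice of all \<open>x \<in> \<int>\<^sup>n\<close> whose
  reduction modulo 2 lies in \<open>C\<close>. The theta series of the coset \<open>c + 2\<int>\<^sup>n\<close> depends only on the
  weight of \<open>c\<close>, so codes with equal weight distributions give equal theta series. We use two
  three-dimensional codes with four words of weight 6 and three of weight 8, supported on 12
  coordinates. In the first code the words of weight 8 sum to zero, hence any two of them have
  even intersection; in the second any two meet in 5 coordinates. Since there are no nonzero words
  of weight at most 4, the vectors of norm 4 recover congruence modulo \<open>2\<int>\<^sup>n\<close>, and an isometry
  would have to preserve the parity of inner products between norm 8 vectors from different
  nonzero cosets.\<close>

section \<open>Integer vectors and lattices built from codes\<close>

definition int_vec :: "('n \<Rightarrow> int) \<Rightarrow> real ^ 'n" where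
  "int_vec u = (\<chi> i. of_int (u i))"

definition odd_set :: "('n \<Rightarrow> int) \<Rightarrow> 'n set" where
  "odd_set u = {i. odd (u i)}"

text \<open>Construction A, without the customary scaling by the inverse square root of 2.\<close>

definition code_lattice :: "'n set set \<Rightarrow> (real ^ 'n) set" where
  "code_lattice C = int_vec ` {u. odd_set u \<in> C}"

lemma inner_int_vec:
  fixes u v :: "'n::finite \<Rightarrow> int"
  shows "int_vec u \<bullet> int_vec v = of_int (\<Sum>i\<in>UNIV. u i * v i)"
  by (simp add: int_vec_def inner_vec_def)

lemma inj_int_vec: "inj (int_vec :: ('n::finite \<Rightarrow> int) \<Rightarrow> real ^ 'n)"
  by (auto simp: inj_def int_vec_def vec_eq_iff fun_eq_iff)

text \<open>An injective endomorphism in finite dimension is also surjective, so it carries the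
  standard basis to a basis, whose integer combinations are the image of the integer
  vectors.\<close>

lemma is_lattice_linear_image:
  fixes T :: "real ^ 'n \<Rightarrow> real ^ 'n"
  assumes "linear T" "inj T"
  shows "is_lattice (T ` range int_vec)"
proof -
  interpret T: linear T by fact
  define b where "b i = T (axis i 1)" for i :: 'n
  have inj_b: "inj b"
    by (auto intro!: injI simp: b_def axis_eq_axis inj_eq[OF assms(2)])
  have range_b: "range b = T ` Basis"
    by (auto simp: b_def Basis_vec_def)
  have T_int_vec: "T (int_vec u) = (\<Sum>i\<in>UNIV. of_int (u i) *\<^sub>R b i)" for u
  proof -
    have "int_vec u = (\<Sum>i\<in>UNIV. of_int (u i) *\<^sub>R axis i (1::real))"
      by (simp add: int_vec_def vec_eq_iff axis_def if_distrib cong: if_cong)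
    then show ?thesis
      by (simp add: b_def T.sum T.scale)
  qed
  have "independent (T ` Basis)"
    using linear_independent_injective_image[OF assms(1) independent_Basis]
      inj_on_subset[OF assms(2)] by simp
  moreover have "span (T ` Basis) = UNIV"
    using linear_injective_imp_surjective[OF assms] by (simp add: span_linear_image[OF assms(1)])
  moreover have "T ` range int_vec
      = {\<Sum>x\<in>range b. of_int (c x) *\<^sub>R x | c :: real ^ 'n \<Rightarrow> int. True}" (is "_ = ?R")
  proof (intro equalityI subsetI)
    fix x assume "x \<in> T ` range int_vec"
    then obtain u where "x = T (int_vec u)" by blast
    also have "\<dots> = (\<Sum>y\<in>range b. of_int (u (inv b y)) *\<^sub>R y)"
      by (simp add: T_int_vec sum.reindex[OF inj_b] inv_f_f[OF inj_b])
    finally show "x \<in> ?R" by (intro CollectI exI[of _ "\<lambda>y. u (inv b y)"]) simp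
  next
    fix x assume "x \<in> ?R"
    then obtain c where "x = (\<Sum>y\<in>range b. of_int (c y) *\<^sub>R y)" by blast
    then have "x = T (int_vec (c \<circ> b))"
      by (simp add: T_int_vec sum.reindex[OF inj_b])
    then show "x \<in> T ` range int_vec" by blast
  qed
  ultimately show ?thesis
    unfolding is_lattice_def range_b by blast
qed

section \<open>Lattice bases from generator matrices\<close>

text \<open>The row space over the field of two elements of a matrix with rows indexed by
  \<open>J\<close>: the column at \<open>i\<close> is the indicator of \<open>s i\<close>, and
  \<open>P\<close> selects the rows to be added.\<close>

definition span_code :: "('n \<Rightarrow> 'n set) \<Rightarrow> 'n set \<Rightarrow> 'n set set" where
  "span_code s J = (\<lambda>P. {i. odd (card (s i \<inter> P))}) ` Pow J"

lemma odd_sum_iff_card: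
  fixes u :: "'n::finite \<Rightarrow> int"
  assumes "A \<subseteq> J"
  shows "odd (\<Sum>j\<in>A. u j) \<longleftrightarrow> odd (card (A \<inter> {j \<in> J. odd (u j)}))"
proof -
  have "A \<inter> {j \<in> J. odd (u j)} = {j \<in> A. odd (u j)}" using assms by blast
  then show ?thesis by (simp add: even_sum_iff)
qed

text \<open>The information set \<open>J\<close> makes the generator matrix triangular: a lattice vector is
  determined by arbitrary integers on \<open>J\<close> and arbitrary even corrections elsewhere.\<close>
lemma integral_lattice_code_lattice:
  fixes s :: "'n::finite \<Rightarrow> 'n set"
  assumes info: "\<And>j. j \<in> J \<Longrightarrow> s j = {j}" and s: "\<And>i. s i \<subseteq> J"
  shows "integral_lattice (code_lattice (span_code s J))"
proof -
  define T :: "real ^ 'n \<Rightarrow> real ^ 'n" where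
    "T y = (\<chi> i. if i \<in> J then y $ i else 2 * y $ i + (\<Sum>j\<in>s i. y $ j))" for y
  \<comment> \<open>The integer counterpart of \<open>T\<close>, on which parity arguments can be
    carried out.\<close>
  define T' :: "('n \<Rightarrow> int) \<Rightarrow> 'n \<Rightarrow> int" where
    "T' u i = (if i \<in> J then u i else 2 * u i + (\<Sum>j\<in>s i. u j))" for u i
  have T_int_vec: "T (int_vec u) = int_vec (T' u)" for u
    by (auto simp: T_def T'_def int_vec_def vec_eq_iff)
  have "linear T"
    by (rule linearI)
      (auto simp: T_def vec_eq_iff sum.distrib sum_distrib_left algebra_simps)
  moreover have "inj T"
  proof (rule injI)
    fix x y assume "T x = T y"
    then have eq: "T x $ i = T y $ i" for i by simp
    have J: "x $ j = y $ j" if "j \<in> J" for j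
      using eq[of j] that by (simp add: T_def)
    have "x $ i = y $ i" if "i \<notin> J" for i
    proof -
      have "(\<Sum>j\<in>s i. x $ j) = (\<Sum>j\<in>s i. y $ j)"
        using s J by (intro sum.cong) auto
      with eq[of i] that show ?thesis by (simp add: T_def)
    qed
    with J show "x = y" by (auto simp: vec_eq_iff)
  qed
  moreover have "T ` range int_vec = code_lattice (span_code s J)"
  proof -
    have "odd_set (T' u) \<in> span_code s J" for u
    proof -
      have "odd_set (T' u) = {i. odd (card (s i \<inter> {j \<in> J. odd (u j)}))}"
      proof -
        have "odd (T' u i) \<longleftrightarrow> odd (\<Sum>j\<in>s i. u j)" for i
          by (auto simp: T'_def info)
        then show ?thesis
          by (simp add: odd_set_def odd_sum_iff_card[OF s])
      qed
      then show ?thesis unfolding span_code_def by blast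
    qed
    moreover have "v \<in> range T'" if v: "odd_set v \<in> span_code s J" for v
    proof -
      obtain P where P: "P \<subseteq> J" "odd_set v = {i. odd (card (s i \<inter> P))}"
        using v by (auto simp: span_code_def)
      have v_odd: "odd (v i) \<longleftrightarrow> odd (card (s i \<inter> P))" for i
        using P(2) by (auto simp: odd_set_def)
      \<comment> \<open>On \<open>J\<close> the word given by \<open>P\<close> is \<open>P\<close>
        itself, since \<open>s j = {j}\<close> there; so \<open>P\<close> can be read off from
        \<open>v\<close>.\<close>
      have "j \<in> P \<longleftrightarrow> odd (v j)" if "j \<in> J" for j
        using v_odd[of j] info[OF that] by (cases "j \<in> P") auto
      with P(1) have P_eq: "P = {j \<in> J. odd (v j)}" by auto
      have ev: "even (v i - (\<Sum>j\<in>s i. v j))" for i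
      proof -
        have "odd (\<Sum>j\<in>s i. v j) \<longleftrightarrow> odd (card (s i \<inter> P))"
          unfolding odd_sum_iff_card[OF s] P_eq ..
        with v_odd[of i] show ?thesis by simp
      qed
      \<comment> \<open>The preimage under \<open>T'\<close>; the division is exact by
        \<open>ev\<close>.\<close>
      define u where "u i = (if i \<in> J then v i else (v i - (\<Sum>j\<in>s i. v j)) div 2)" for i
      have "(\<Sum>j\<in>s i. u j) = (\<Sum>j\<in>s i. v j)" for i
        using s by (intro sum.cong) (auto simp: u_def)
      then have "T' u = v"
        using ev by (auto simp: T'_def u_def fun_eq_iff)
      then show ?thesis by blast
    qed
    ultimately have "range T' = {v. odd_set v \<in> span_code s J}" by blast
    then have "int_vec ` range T' = code_lattice (span_code s J)"
      by (simp add: code_lattice_def)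
    then show ?thesis by (simp add: image_image T_int_vec)
  qed
  ultimately have "is_lattice (code_lattice (span_code s J))"
    using is_lattice_linear_image by metis
  then show ?thesis
    unfolding integral_lattice_def code_lattice_def by (auto simp: inner_int_vec)
qed

section \<open>Equality of theta series\<close>

text \<open>Words of equal weight differ by a permutation of the coordinates. Applying to each coset
  its own permutation gives a norm-preserving bijection between the lattices, along which the sum is
  reindexed.\<close>

lemma theta_code_lattice_eq:
  fixes C1 C2 :: "'n::finite set set"
  assumes \<tau>: "bij_betw \<tau> C1 C2" and card: "\<And>W. W \<in> C1 \<Longrightarrow> card (\<tau> W) = card W"
  shows "theta (code_lattice C1) z = theta (code_lattice C2) z"
proof -
  have "\<exists>\<sigma>. bij \<sigma> \<and> \<sigma> ` W = \<tau> W" if W: "W \<in> C1" for W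
  proof -
    \<comment> \<open>A bijection from \<open>W\<close> to \<open>\<tau> W\<close> and one between
      the complements glue to a permutation.\<close>
    have "card (- W) = card (- \<tau> W)"
      using card[OF W] by (simp add: Compl_eq_Diff_UNIV card_Diff_subset)
    then obtain f g where f: "bij_betw f W (\<tau> W)" and g: "bij_betw g (- W) (- \<tau> W)"
      using card[OF W] finite_same_card_bij by (metis finite)
    have "bij_betw (\<lambda>i. if i \<in> W then f i else g i) (W \<union> - W) (\<tau> W \<union> - \<tau> W)"
      by (intro bij_betw_disjoint_Un f g) auto
    moreover have "(\<lambda>i. if i \<in> W then f i else g i) ` W = \<tau> W"
      using f by (auto simp: bij_betw_def)
    ultimately show ?thesis by (intro exI[of _ "\<lambda>i. if i \<in> W then f i else g i"]) simp
  qed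
  then obtain \<sigma> where bij: "\<And>W. W \<in> C1 \<Longrightarrow> bij (\<sigma> W)"
    and \<sigma>: "\<And>W. W \<in> C1 \<Longrightarrow> \<sigma> W ` W = \<tau> W" by metis
  \<comment> \<open>The permutation depends on the class of \<open>u\<close> modulo 2, so
    \<open>F\<close> need not be additive. \<open>G\<close> undoes it, recovering the original class
    from that of the image.\<close>
  define F where "F u = u \<circ> inv (\<sigma> (odd_set u))" for u :: "'n \<Rightarrow> int"
  define G where "G v = v \<circ> \<sigma> (inv_into C1 \<tau> (odd_set v))" for v :: "'n \<Rightarrow> int"
  have odd_F: "odd_set (F u) = \<tau> (odd_set u)" if "odd_set u \<in> C1" for u
  proof -
    have "odd_set (F u) = \<sigma> (odd_set u) ` odd_set u"
      using bij[OF that] unfolding F_def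
      by (auto simp: odd_set_def bij_is_surj surj_f_inv_f bij_inv_eq_iff image_iff inv_f_f bij_is_inj
          intro!: exI[of _ "inv _ _"])
    then show ?thesis using \<sigma>[OF that] by simp
  qed
  have odd_G: "odd_set (G v) = inv_into C1 \<tau> (odd_set v)" if v: "odd_set v \<in> C2" for v
  proof -
    define W where "W = inv_into C1 \<tau> (odd_set v)"
    have W: "W \<in> C1" "\<tau> W = odd_set v"
      using v \<tau> by (auto simp: W_def bij_betw_def inv_into_into f_inv_into_f)
    have "odd_set (G v) = \<sigma> W -` (\<sigma> W ` W)"
      using \<sigma>[OF W(1)] W(2) by (auto simp: G_def odd_set_def W_def)
    also have "\<dots> = W" using bij[OF W(1)] by (simp add: bij_is_inj inj_vimage_image_eq)
    finally show ?thesis by (simp add: W_def)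
  qed
  have \<tau>_inv: "inv_into C1 \<tau> (\<tau> W) = W" if "W \<in> C1" for W
    using \<tau> that by (simp add: bij_betw_def inv_into_f_f)
  have bij_F: "bij_betw F {u. odd_set u \<in> C1} {v. odd_set v \<in> C2}"
  proof (rule bij_betw_byWitness[where f' = G])
    show "\<forall>u\<in>{u. odd_set u \<in> C1}. G (F u) = u"
      using bij by (auto simp: G_def odd_F \<tau>_inv) (auto simp: F_def fun_eq_iff bij_is_inj)
    show "\<forall>v\<in>{v. odd_set v \<in> C2}. F (G v) = v"
    proof safe
      fix v assume v: "odd_set v \<in> C2"
      then have "inv_into C1 \<tau> (odd_set v) \<in> C1"
        using \<tau> by (auto simp: bij_betw_def inv_into_into)
      from bij[OF this] show "F (G v) = v"
        by (simp add: F_def odd_G[OF v]) (simp add: G_def fun_eq_iff bij_is_surj surj_f_inv_f)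
    qed
    show "F ` {u. odd_set u \<in> C1} \<subseteq> {v. odd_set v \<in> C2}"
      using \<tau> by (auto simp: odd_F bij_betw_def)
    show "G ` {v. odd_set v \<in> C2} \<subseteq> {u. odd_set u \<in> C1}"
      using \<tau> by (auto simp: odd_G bij_betw_def inv_into_into)
  qed
  have norm_F: "int_vec (F u) \<bullet> int_vec (F u) = int_vec u \<bullet> int_vec u" if "odd_set u \<in> C1" for u
  proof -
    have "bij (inv (\<sigma> (odd_set u)))" using bij[OF that] by (rule bij_imp_bij_inv)
    then have "(\<Sum>i\<in>UNIV. F u i * F u i) = (\<Sum>i\<in>UNIV. u i * u i)"
      unfolding F_def o_def by (rule sum.reindex_bij_betw)
    then show ?thesis by (simp add: inner_int_vec)
  qed
  have theta: "theta (code_lattice C) z = (\<Sum>\<^sub>\<infinity>u | odd_set u \<in> C.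
      exp (of_real pi * \<i> * z * of_real (int_vec u \<bullet> int_vec u)))" for C :: "'n set set"
    unfolding theta_def code_lattice_def
    by (subst infsum_reindex) (auto intro: inj_on_subset[OF inj_int_vec] simp: o_def)
  show ?thesis
    unfolding theta infsum_reindex_bij_betw[OF bij_F, symmetric]
    by (intro infsum_cong) (simp add: norm_F)
qed

section \<open>Non-isomorphism from norms and inner products\<close>

text \<open>In a code lattice without nonzero words of weight at most 4, the vectors of norm 4 are
  divisible by 2 and include all \<open>2 e\<^sub>i\<close>. So this relation is congruence modulo \<open>2\<int>\<^sup>n\<close>,
  expressed through inner products alone.\<close>
definition cong_by_norm4 :: "'a::euclidean_space set \<Rightarrow> 'a \<Rightarrow> 'a \<Rightarrow> bool" where
  "cong_by_norm4 L x y \<longleftrightarrow> (\<forall>v\<in>L. v \<bullet> v = 4 \<longrightarrow> (x \<bullet> v - y \<bullet> v) / 4 \<in> \<int>)"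

text \<open>Every odd entry contributes at least 1 to the norm. This keeps short vectors out of the
  cosets of heavy words.\<close>

lemma card_odd_set_le:
  fixes u :: "'n::finite \<Rightarrow> int"
  shows "int (card (odd_set u)) \<le> (\<Sum>i\<in>UNIV. u i * u i)"
proof -
  have "int (card (odd_set u)) = (\<Sum>i\<in>odd_set u. 1)" by simp
  also have "\<dots> \<le> (\<Sum>i\<in>odd_set u. u i * u i)"
  proof (rule sum_mono)
    fix i assume "i \<in> odd_set u"
    then have "u i \<noteq> 0" by (auto simp: odd_set_def)
    then have "0 < u i * u i" by (auto simp: zero_less_mult_iff)
    then show "1 \<le> u i * u i" by linarith
  qed
  also have "\<dots> \<le> (\<Sum>i\<in>UNIV. u i * u i)"
    by (rule sum_mono2) auto
  finally show ?thesis .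
qed

lemma cong_by_norm4_iff:
  fixes C :: "'n::finite set set"
  assumes "{} \<in> C" and min: "\<And>W. W \<in> C \<Longrightarrow> W \<noteq> {} \<Longrightarrow> 4 < card W"
  shows "cong_by_norm4 (code_lattice C) (int_vec u) (int_vec v) \<longleftrightarrow> odd_set u = odd_set v"
proof
  assume cong: "cong_by_norm4 (code_lattice C) (int_vec u) (int_vec v)"
  have "even (u i - v i)" for i
  proof -
    \<comment> \<open>Twice the standard basis vector at \<open>i\<close>: it has norm 4, belongs to
      the zero word, and tests the parity of a single entry.\<close>
    define w :: "'n \<Rightarrow> int" where "w j = (if j = i then 2 else 0)" for j
    have "odd_set w = {}" by (auto simp: odd_set_def w_def)
    then have "int_vec w \<in> code_lattice C" using assms(1) by (auto simp: code_lattice_def)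
    moreover have sum_w: "(\<Sum>j\<in>UNIV. a j * w j) = 2 * a i" for a
      by (simp add: w_def if_distrib cong: if_cong)
    have "int_vec w \<bullet> int_vec w = 4"
      unfolding inner_int_vec sum_w by (simp add: w_def)
    ultimately have "(int_vec u \<bullet> int_vec w - int_vec v \<bullet> int_vec w) / 4 \<in> \<int>"
      using cong by (auto simp: cong_by_norm4_def)
    then obtain k :: int where "real_of_int (2 * u i - 2 * v i) / 4 = of_int k"
      unfolding inner_int_vec sum_w by (auto elim: Ints_cases)
    then have "real_of_int (u i - v i) = real_of_int (2 * k)" by simp
    then have "u i - v i = 2 * k" by linarith
    then show ?thesis by simp
  qed
  then show "odd_set u = odd_set v" by (auto simp: odd_set_def)
next
  assume eq: "odd_set u = odd_set v"
  have "(int_vec u \<bullet> x - int_vec v \<bullet> x) / 4 \<in> \<int>"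
    if x: "x \<in> code_lattice C" "x \<bullet> x = 4" for x
  proof -
    obtain w where w: "x = int_vec w" "odd_set w \<in> C"
      using x(1) by (auto simp: code_lattice_def)
    have "real_of_int (\<Sum>i\<in>UNIV. w i * w i) = of_int 4"
      using x(2) by (simp add: w(1) inner_int_vec del: of_int_sum)
    then have "(\<Sum>i\<in>UNIV. w i * w i) = 4" by linarith
    \<comment> \<open>The norm bounds the weight by 4, and \<open>min\<close> then leaves only the
      empty word.\<close>
    then have "odd_set w = {}"
      using card_odd_set_le[of w] min[OF w(2)] by fastforce
    then have "2 dvd w i" for i by (auto simp: odd_set_def)
    moreover have "2 dvd u i - v i" for i
      using eq by (auto simp: odd_set_def)
    ultimately have "2 * 2 dvd (u i - v i) * w i" for i
      by (intro mult_dvd_mono) auto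
    then have "4 dvd (\<Sum>i\<in>UNIV. (u i - v i) * w i)"
      by (intro dvd_sum) simp
    then obtain k where k: "(\<Sum>i\<in>UNIV. (u i - v i) * w i) = 4 * k" by blast
    have "int_vec u \<bullet> x - int_vec v \<bullet> x = real_of_int (\<Sum>i\<in>UNIV. (u i - v i) * w i)"
      by (simp add: w(1) inner_int_vec sum_subtractf left_diff_distrib)
    then show ?thesis by (simp add: k)
  qed
  then show "cong_by_norm4 (code_lattice C) (int_vec u) (int_vec v)"
    by (auto simp: cong_by_norm4_def)
qed

text \<open>The relation involves inner products only, and \<open>f\<close> maps the norm 4 vectors
  of \<open>L1\<close> onto those of \<open>L2\<close>.\<close>

lemma cong_by_norm4_bij:
  assumes "bij_betw f L1 L2" "\<forall>x\<in>L1. \<forall>y\<in>L1. f x \<bullet> f y = x \<bullet> y" "x \<in> L1" "y \<in> L1"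
  shows "cong_by_norm4 L2 (f x) (f y) \<longleftrightarrow> cong_by_norm4 L1 x y"
proof -
  have "L2 = f ` L1" using assms(1) by (simp add: bij_betw_def)
  then show ?thesis using assms(2-4) by (simp add: cong_by_norm4_def)
qed

text \<open>Odd squares are 1 and even squares 0 modulo 4, so the norm determines the weight of the
  word modulo 4.\<close>

lemma norm_int_vec_mod_4:
  fixes u :: "'n::finite \<Rightarrow> int"
  shows "(\<Sum>i\<in>UNIV. u i * u i) mod 4 = int (card (odd_set u)) mod 4"
proof -
  have "u i * u i mod 4 = of_bool (odd (u i)) mod 4" for i
  proof (cases "even (u i)")
    case True
    then obtain k where "u i = 2 * k" by blast
    then show ?thesis by simp
  next
    case False
    then obtain k where "u i = 2 * k + 1" by (rule oddE)
    then have "u i * u i = 1 + 4 * (k * k + k)" by (simp add: algebra_simps)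
    then show ?thesis using False by (simp only: mod_mult_self2) simp
  qed
  then have "(\<Sum>i\<in>UNIV. u i * u i) mod 4 = (\<Sum>i\<in>UNIV. of_bool (odd (u i))) mod 4"
    by (metis (mono_tags, lifting) mod_sum_eq sum.cong)
  then show ?thesis by (simp add: odd_set_def)
qed

lemma odd_inner_int_vec:
  fixes u v :: "'n::finite \<Rightarrow> int"
  shows "odd (\<Sum>i\<in>UNIV. u i * v i) \<longleftrightarrow> odd (card (odd_set u \<inter> odd_set v))"
proof -
  have "odd_set u \<inter> odd_set v = {i \<in> UNIV. odd (u i * v i)}" by (auto simp: odd_set_def)
  then show ?thesis by (simp add: even_sum_iff)
qed

text \<open>An isometry may send the indicator of \<open>X\<close> to a vector that is not an
  indicator. Its norm 8 then shows only that the weight of its word is divisible by 4, which is why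
  \<open>odd\<close> is stated for all such words.\<close>

lemma not_lattice_isomorphic_code_lattice:
  fixes C1 C2 :: "'n::finite set set"
  assumes C1: "{} \<in> C1" "\<And>W. W \<in> C1 \<Longrightarrow> W \<noteq> {} \<Longrightarrow> 4 < card W"
    and C2: "{} \<in> C2" "\<And>W. W \<in> C2 \<Longrightarrow> W \<noteq> {} \<Longrightarrow> 4 < card W"
    and XY: "X \<in> C1" "Y \<in> C1" "card X = 8" "card Y = 8" "X \<noteq> Y" "even (card (X \<inter> Y))"
    and odd: "\<And>X Y. X \<in> C2 \<Longrightarrow> Y \<in> C2 \<Longrightarrow> X \<noteq> {} \<Longrightarrow> Y \<noteq> {} \<Longrightarrow> X \<noteq> Y \<Longrightarrow>
      4 dvd card X \<Longrightarrow> 4 dvd card Y \<Longrightarrow> odd (card (X \<inter> Y))"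
  shows "\<not> lattice_isomorphic (code_lattice C1) (code_lattice C2)"
proof
  assume "lattice_isomorphic (code_lattice C1) (code_lattice C2)"
  then obtain f where bij: "bij_betw f (code_lattice C1) (code_lattice C2)"
    and inner: "\<forall>x\<in>code_lattice C1. \<forall>y\<in>code_lattice C1. f x \<bullet> f y = x \<bullet> y"
    by (auto simp: lattice_isomorphic_def)
  have image: "\<exists>u'. odd_set u' \<in> C2 \<and> f (int_vec u) = int_vec u'" if "odd_set u \<in> C1" for u
  proof -
    have "f (int_vec u) \<in> code_lattice C2"
      using bij that by (auto simp: bij_betw_def code_lattice_def)
    then show ?thesis by (auto simp: code_lattice_def)
  qed
  define ind :: "'n set \<Rightarrow> 'n \<Rightarrow> int" where "ind W i = of_bool (i \<in> W)" for W i
  have odd_ind: "odd_set (ind W) = W" for W by (auto simp: odd_set_def ind_def)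
  have inner_ind: "(\<Sum>i\<in>UNIV. ind V i * ind W i) = int (card (V \<inter> W))" for V W
  proof -
    have "ind V i * ind W i = of_bool (i \<in> V \<inter> W)" for i by (auto simp: ind_def)
    then show ?thesis by (simp flip: Int_def)
  qed
  obtain x y o' where x: "odd_set x \<in> C2" "f (int_vec (ind X)) = int_vec x"
    and y: "odd_set y \<in> C2" "f (int_vec (ind Y)) = int_vec y"
    and o': "odd_set o' \<in> C2" "f (int_vec (ind {})) = int_vec o'"
    using image[of "ind X"] image[of "ind Y"] image[of "ind {}"] XY C1(1)
    by (auto simp: odd_ind)
  have mem: "int_vec (ind W) \<in> code_lattice C1" if "W \<in> C1" for W
    using that by (auto simp: code_lattice_def odd_ind)
  have cong: "odd_set u = odd_set v \<longleftrightarrow> U = V"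
    if "U \<in> C1" "V \<in> C1" "f (int_vec (ind U)) = int_vec u" "f (int_vec (ind V)) = int_vec v"
    for U V u v
    using cong_by_norm4_bij[OF bij inner mem[OF that(1)] mem[OF that(2)]]
      cong_by_norm4_iff[OF C1] cong_by_norm4_iff[OF C2] that(3,4) by (simp add: odd_ind)
  have inner': "(\<Sum>i\<in>UNIV. u i * v i) = int (card (U \<inter> V))"
    if "U \<in> C1" "V \<in> C1" "f (int_vec (ind U)) = int_vec u" "f (int_vec (ind V)) = int_vec v"
    for U V u v
    using inner[rule_format, OF mem[OF that(1)] mem[OF that(2)]]
    unfolding that(3,4) inner_int_vec inner_ind of_int_eq_iff .
  \<comment> \<open>The image of the zero vector has norm 0, so it represents the zero
    class.\<close>
  have "odd_set o' = {}"
    using inner'[OF C1(1) C1(1) o'(2) o'(2)] card_odd_set_le[of o'] by simp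
  then have "odd_set x \<noteq> {}" "odd_set y \<noteq> {}" "odd_set x \<noteq> odd_set y"
    using cong[OF XY(1) C1(1) x(2) o'(2)] cong[OF XY(2) C1(1) y(2) o'(2)]
      cong[OF XY(1,2) x(2) y(2)] XY by auto
  moreover have "4 dvd card (odd_set x)" "4 dvd card (odd_set y)"
  proof -
    have "int (card (odd_set x)) mod 4 = 0" "int (card (odd_set y)) mod 4 = 0"
      unfolding norm_int_vec_mod_4[symmetric] inner'[OF XY(1,1) x(2) x(2)]
        inner'[OF XY(2,2) y(2) y(2)]
      by (simp_all add: XY)
    then show "4 dvd card (odd_set x)" "4 dvd card (odd_set y)"
      by (simp_all flip: int_dvd_int_iff add: dvd_eq_mod_eq_0)
  qed
  ultimately have "odd (card (odd_set x \<inter> odd_set y))"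
    using odd x(1) y(1) by blast
  then show False
    using odd_inner_int_vec[of x y] inner'[OF XY(1,2) x(2) y(2)] XY(6) by simp
qed

section \<open>Codes given by lists of columns\<close>

text \<open>The list holds the columns of a generator matrix as sets of row indices; the value is
  the support of the sum of the rows in \<open>Q\<close>.\<close>

definition word :: "nat set list \<Rightarrow> nat set \<Rightarrow> nat set" where
  "word cs Q = {n. n < length cs \<and> odd (card (cs ! n \<inter> Q))}"

text \<open>\<open>g\<close> places the positions of the list in the index type. All other
  coordinates are zero in every word, so a short code can be padded to any larger length.\<close>

definition column_code :: "(nat \<Rightarrow> 'n) \<Rightarrow> nat \<Rightarrow> nat set list \<Rightarrow> 'n set set" where
  "column_code g k cs = (\<lambda>Q. g ` word cs Q) ` Pow {..<k}"

lemma integral_lattice_column_code: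
  fixes g :: "nat \<Rightarrow> 'n::finite"
  assumes g: "bij_betw g {..<N} UNIV" and len: "k \<le> length cs" "length cs \<le> N"
    and info: "\<And>n. n < k \<Longrightarrow> cs ! n = {n}" and cs: "\<And>n. n < length cs \<Longrightarrow> cs ! n \<subseteq> {..<k}"
  shows "integral_lattice (code_lattice (column_code g k cs))"
proof -
  define h where "h = inv_into {..<N} g"
  have inj: "inj_on g {..<N}" using g by (simp add: bij_betw_def)
  have h: "h (g n) = n" if "n < N" for n
    using inj that by (simp add: h_def inv_into_f_f)
  have g_h: "g (h i) = i" for i
    using g by (simp add: h_def bij_betw_inv_into_right)
  \<comment> \<open>Coordinates beyond the list receive the empty column.\<close>
  define s where "s i = (if h i < length cs then g ` (cs ! h i) else {})" for i
  have word: "{i. odd (card (s i \<inter> g ` Q))} = g ` word cs Q" if Q: "Q \<subseteq> {..<k}" for Q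
  proof -
    have "odd (card (s i \<inter> g ` Q)) \<longleftrightarrow> h i \<in> word cs Q" for i
    proof (cases "h i < length cs")
      case True
      have sub: "cs ! h i \<subseteq> {..<N}" "Q \<subseteq> {..<N}" using cs[OF True] Q len by force+
      then have "s i \<inter> g ` Q = g ` (cs ! h i \<inter> Q)"
        using True by (simp add: s_def inj_on_image_Int[OF inj])
      moreover have "card (g ` (cs ! h i \<inter> Q)) = card (cs ! h i \<inter> Q)"
        using sub by (intro card_image inj_on_subset[OF inj]) auto
      ultimately show ?thesis using True by (simp add: word_def)
    qed (simp add: s_def word_def)
    moreover have "h i \<in> word cs Q \<longleftrightarrow> i \<in> g ` word cs Q" for i
    proof
      assume "h i \<in> word cs Q"
      then show "i \<in> g ` word cs Q" using g_h[of i] by (metis imageI)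
    next
      assume "i \<in> g ` word cs Q"
      then show "h i \<in> word cs Q" using h len by (auto simp: word_def)
    qed
    ultimately show ?thesis by blast
  qed
  have "column_code g k cs = span_code s (g ` {..<k})"
    unfolding column_code_def span_code_def image_Pow_surj[OF refl, symmetric] image_image
    by (intro image_cong) (auto simp: word)
  moreover have "integral_lattice (code_lattice (span_code s (g ` {..<k})))"
  proof (rule integral_lattice_code_lattice)
    show "s j = {j}" if "j \<in> g ` {..<k}" for j
      using that h info len by (auto simp: s_def)
    show "s i \<subseteq> g ` {..<k}" for i
      using cs by (auto simp: s_def)
  qed
  ultimately show ?thesis by simp
qed

text \<open>The first \<open>k\<close> columns are unit columns, so the part of the word below
  \<open>k\<close> is \<open>Q\<close>.\<close>

lemma inj_on_word:
  assumes "k \<le> length cs" "\<And>n. n < k \<Longrightarrow> cs ! n = {n}"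
  shows "inj_on (word cs) (Pow {..<k})"
proof (rule inj_on_inverseI)
  fix Q assume "Q \<in> Pow {..<k}"
  moreover have "odd (card ({n} \<inter> Q)) \<longleftrightarrow> n \<in> Q" for n
    by (cases "n \<in> Q") auto
  ultimately show "word cs Q \<inter> {..<k} = Q"
    using assms by (auto simp: word_def)
qed

section \<open>The two explicit codes and the final construction\<close>

text \<open>The nonzero words of a three-dimensional code are the points of a Fano plane, and arbitrary
  weights on these points determine the column multiplicities by inverting the incidence matrix.
  Here the words of weight 8 form a line for \<open>cs1\<close> and a triangle for \<open>cs2\<close>.\<close>
definition cs1 :: "nat set list" where
  "cs1 = [{0}, {1}, {2}, {0}, {1}, {2}, {0,1}, {0,1}, {0,2}, {0,2}, {1,2}, {1,2}]"

definition cs2 :: "nat set list" where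
  "cs2 = [{0}, {1}, {2}, {0,1}, {0,1}, {0,2}, {0,2}, {1,2}, {1,2}, {0,1,2}, {0,1,2}, {0,1,2}]"

lemma Pow_3: "Pow {..<3::nat} = {{}, {0}, {1}, {2}, {0,1}, {0,2}, {1,2}, {0,1,2}}"
proof -
  have "{..<3::nat} = {0,1,2}" by auto
  then show ?thesis by (simp add: Pow_insert insert_commute)
qed

lemma length_cs: "length cs1 = 12" "length cs2 = 12"
  by (simp_all add: cs1_def cs2_def)

text \<open>With the positions listed explicitly, words can be evaluated by simplification.\<close>

lemma word_eq_filter:
  assumes "length cs = 12"
  shows "word cs Q = set (filter (\<lambda>n. odd (card (cs ! n \<inter> Q))) [0,1,2,3,4,5,6,7,8,9,10,11])"
proof -
  have "n < 12 \<longleftrightarrow> n \<in> set [0,1,2,3,4,5,6,7,8,9,10,11]" for n :: nat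
    by (simp add: numeral_eq_Suc less_Suc_eq disj_ac)
  then show ?thesis unfolding word_def assms set_filter by simp
qed

lemma word_cs1:
  "word cs1 {} = {}"
  "word cs1 {0} = {0,3,6,7,8,9}"
  "word cs1 {1} = {1,4,6,7,10,11}"
  "word cs1 {2} = {2,5,8,9,10,11}"
  "word cs1 {0,1} = {0,1,3,4,8,9,10,11}"
  "word cs1 {0,2} = {0,2,3,5,6,7,10,11}"
  "word cs1 {1,2} = {1,2,4,5,6,7,8,9}"
  "word cs1 {0,1,2} = {0,1,2,3,4,5}"
  by (simp_all only: word_eq_filter[OF length_cs(1)]) (simp_all add: cs1_def)

lemma word_cs2:
  "word cs2 {} = {}"
  "word cs2 {0} = {0,3,4,5,6,9,10,11}"
  "word cs2 {1} = {1,3,4,7,8,9,10,11}"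
  "word cs2 {2} = {2,5,6,7,8,9,10,11}"
  "word cs2 {0,1} = {0,1,5,6,7,8}"
  "word cs2 {0,2} = {0,2,3,4,7,8}"
  "word cs2 {1,2} = {1,2,3,4,5,6}"
  "word cs2 {0,1,2} = {0,1,2,9,10,11}"
  by (simp_all only: word_eq_filter[OF length_cs(2)]) (simp_all add: cs2_def)

lemma nth_cs_info:
  assumes "n < 3"
  shows "cs1 ! n = {n}" "cs2 ! n = {n}"
proof -
  have "n \<in> {0, 1, 2}" using assms by auto
  then show "cs1 ! n = {n}" "cs2 ! n = {n}" by (auto simp: cs1_def cs2_def)
qed

lemma nth_cs_subset:
  assumes "n < 12"
  shows "cs1 ! n \<subseteq> {..<3}" "cs2 ! n \<subseteq> {..<3}"
proof -
  have "\<forall>A\<in>set cs1 \<union> set cs2. A \<subseteq> {..<3}" by (simp add: cs1_def cs2_def)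
  then show "cs1 ! n \<subseteq> {..<3}" "cs2 ! n \<subseteq> {..<3}"
    using assms by (simp_all add: length_cs)
qed

theorem theorem1p3:
  fixes d :: nat
  assumes "d \<in> {24, 27, 30, 33, 35, 36, 38, 39, 41, 42} \<union> {i. i \<ge> 44}"
    and "CARD('n::finite) = 4 * d"
  shows "\<exists>L1 L2 :: (real ^ 'n) set.
           integral_lattice L1 \<and> integral_lattice L2 \<and>
           \<not> lattice_isomorphic L1 L2 \<and>
           (\<forall>z. Im z > 0 \<longrightarrow> theta L1 z = theta L2 z)"
proof -
  define N where "N = CARD('n)"
  \<comment> \<open>The codes occupy 12 coordinates, which must fit into the index type.\<close>
  have N: "12 \<le> N" using assms by (auto simp: N_def)
  obtain g :: "nat \<Rightarrow> 'n" where g: "bij_betw g {..<N} UNIV"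
    using ex_bij_betw_nat_finite[OF finite[of "UNIV :: 'n set"]]
    by (auto simp: N_def atLeast0LessThan)
  have inj: "inj_on g {..<12}"
    using g N by (auto simp: bij_betw_def intro: inj_on_subset)
  let ?C1 = "column_code g 3 cs1" and ?C2 = "column_code g 3 cs2"
  have sub: "word cs1 Q \<subseteq> {..<12}" "word cs2 Q \<subseteq> {..<12}" for Q
    by (auto simp: word_def length_cs nth_cs_info nth_cs_subset)
  have card: "card (g ` A) = card A" if "A \<subseteq> {..<12}" for A
    using that by (intro card_image inj_on_subset[OF inj])
  note cards = card[OF sub(1)] card[OF sub(2)]
  have inj_word: "inj_on (\<lambda>Q. g ` word cs Q) (Pow {..<3})"
    if "length cs = 12" "\<And>n. n < 3 \<Longrightarrow> cs ! n = {n}" for cs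
  proof -
    have "inj_on ((`) g \<circ> word cs) (Pow {..<3})"
      by (intro comp_inj_on inj_on_word inj_on_subset[OF inj_on_image_Pow[OF inj]])
        (use that in \<open>auto simp: word_def\<close>)
    then show ?thesis by (simp add: o_def)
  qed
  \<comment> \<open>The weight is 8 on pairs for \<open>cs1\<close> and on singletons for \<open>cs2\<close>.\<close>
  define p :: "nat set \<Rightarrow> nat set" where
    "p Q = (if card Q \<in> {1, 2} then {0,1,2} - Q else Q)" for Q
  have p: "p {} = {}" "p {0} = {1,2}" "p {1} = {0,2}" "p {2} = {0,1}"
    "p {0,1} = {2}" "p {0,2} = {1}" "p {1,2} = {0}" "p {0,1,2} = {0,1,2}"
    by (simp_all add: p_def insert_Diff_if del: One_nat_def)
  \<comment> \<open>\<open>p\<close> is an involution.\<close>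
  have "bij_betw p (Pow {..<3}) (Pow {..<3})"
    by (rule bij_betw_byWitness[where f' = p]) (simp_all add: Pow_3 p del: One_nat_def)
  then have "bij_betw (\<lambda>Q. g ` word cs2 (p Q)) (Pow {..<3}) ?C2"
    using bij_betw_trans[OF _ inj_on_imp_bij_betw[OF inj_word[OF length_cs(2) nth_cs_info(2)]]] by (auto simp: o_def column_code_def)
  moreover have bij1: "bij_betw (\<lambda>Q. g ` word cs1 Q) (Pow {..<3}) ?C1"
    using inj_on_imp_bij_betw[OF inj_word[OF length_cs(1) nth_cs_info(1)]] by (simp add: column_code_def)
  \<comment> \<open>A word of the first code is traced back to its row selection, which
    \<open>p\<close> turns into that of a word of the second code.\<close>
  ultimately have bij: "bij_betw
      ((\<lambda>Q. g ` word cs2 (p Q)) \<circ> inv_into (Pow {..<3}) (\<lambda>Q. g ` word cs1 Q)) ?C1 ?C2"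
    using bij_betw_inv_into bij_betw_trans by blast
  have weight: "card (word cs2 (p Q)) = card (word cs1 Q)" if "Q \<in> Pow {..<3}" for Q
    using that unfolding Pow_3
    by (elim insertE emptyE) (simp_all add: p word_cs1 word_cs2 del: One_nat_def)
  have theta: "theta (code_lattice ?C1) z = theta (code_lattice ?C2) z" for z
  proof (rule theta_code_lattice_eq[OF bij])
    fix W assume "W \<in> ?C1"
    then obtain Q where "Q \<in> Pow {..<3}" "W = g ` word cs1 Q"
      by (auto simp: column_code_def)
    then show "card (((\<lambda>Q. g ` word cs2 (p Q)) \<circ>
        inv_into (Pow {..<3}) (\<lambda>Q. g ` word cs1 Q)) W) = card W"
      using bij_betw_inv_into_left[OF bij1] weight by (simp add: cards)
  qed
  have "\<not> lattice_isomorphic (code_lattice ?C1) (code_lattice ?C2)"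
  proof (rule not_lattice_isomorphic_code_lattice)
    show "{} \<in> ?C1" "{} \<in> ?C2"
      unfolding column_code_def Pow_3 by (simp_all add: word_cs1 word_cs2)
    show "4 < card W" if W: "W \<in> ?C1" "W \<noteq> {}" for W
    proof -
      obtain Q where Q: "Q \<in> Pow {..<3}" "W = g ` word cs1 Q"
        using W(1) by (auto simp: column_code_def)
      have "word cs1 Q \<noteq> {} \<Longrightarrow> 4 < card (word cs1 Q)"
        using Q(1) unfolding Pow_3
        by (elim insertE emptyE) (simp_all add: word_cs1 del: One_nat_def)
      then show ?thesis using W(2) by (simp add: Q(2) cards)
    qed
    show "4 < card W" if W: "W \<in> ?C2" "W \<noteq> {}" for W
    proof -
      obtain Q where Q: "Q \<in> Pow {..<3}" "W = g ` word cs2 Q"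
        using W(1) by (auto simp: column_code_def)
      have "word cs2 Q \<noteq> {} \<Longrightarrow> 4 < card (word cs2 Q)"
        using Q(1) unfolding Pow_3
        by (elim insertE emptyE) (simp_all add: word_cs2 del: One_nat_def)
      then show ?thesis using W(2) by (simp add: Q(2) cards)
    qed
    \<comment> \<open>The sum of these two words of weight 8 is the third one, so they meet in (8 +
      8 - 8) / 2 = 4 coordinates.\<close>
    let ?X = "word cs1 {0,1}" and ?Y = "word cs1 {0,2}"
    show "g ` ?X \<in> ?C1" "g ` ?Y \<in> ?C1"
      by (auto simp: column_code_def)
    show "card (g ` ?X) = 8" "card (g ` ?Y) = 8"
      unfolding cards by (simp_all add: word_cs1 del: One_nat_def)
    have "?X \<inter> ?Y = {0,3,10,11}" by (simp add: word_cs1 del: One_nat_def)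
    then have "card (g ` ?X \<inter> g ` ?Y) = 4"
      using card[of "{0,3,10,11}"]
      unfolding inj_on_image_Int[OF inj sub(1) sub(1), symmetric] by simp
    \<comment> \<open>Equal words would meet in 8 coordinates instead of 4.\<close>
    then show "even (card (g ` ?X \<inter> g ` ?Y))" "g ` ?X \<noteq> g ` ?Y"
      using \<open>card (g ` ?X) = 8\<close> by auto
    fix X Y
    assume XY: "X \<in> ?C2" "Y \<in> ?C2" "X \<noteq> {}" "Y \<noteq> {}" "X \<noteq> Y" "4 dvd card X" "4 dvd card Y"
    then obtain Q R where QR: "Q \<in> Pow {..<3}" "X = g ` word cs2 Q"
        "R \<in> Pow {..<3}" "Y = g ` word cs2 R"
      by (auto simp: column_code_def)
    \<comment> \<open>The remaining nonzero words have weight 6.\<close>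
    have triangle: "Q \<in> {{0},{1},{2}}"
      if "Q \<in> Pow {..<3}" "word cs2 Q \<noteq> {}" "4 dvd card (word cs2 Q)" for Q
      using that unfolding Pow_3
      by (elim insertE emptyE) (simp_all add: word_cs2 flip: One_nat_def)
    have "Q \<in> {{0},{1},{2}}" "R \<in> {{0},{1},{2}}" "Q \<noteq> R"
      using triangle[of Q] triangle[of R] XY QR by (auto simp: cards)
    \<comment> \<open>The sum of two such words has weight 6, so they meet in (8 + 8 - 6) / 2 = 5
      coordinates.\<close>
    then have "card (word cs2 Q \<inter> word cs2 R) = 5"
      by (elim insertE emptyE) (simp_all add: word_cs2 del: One_nat_def)
    moreover have "card (X \<inter> Y) = card (word cs2 Q \<inter> word cs2 R)"
      using card[of "word cs2 Q \<inter> word cs2 R"] sub(2)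
      unfolding QR inj_on_image_Int[OF inj sub(2) sub(2), symmetric] by blast
    ultimately show "odd (card (X \<inter> Y))" by simp
  qed
  moreover have "integral_lattice (code_lattice ?C1)" "integral_lattice (code_lattice ?C2)"
    by (intro integral_lattice_column_code[OF g]; use N in \<open>simp add: length_cs nth_cs_info nth_cs_subset\<close>)+
  ultimately show ?thesis using theta by blast
qed

end
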